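(* Let $(H,\Delta,\epsilon,\Phi)$ be a quasi-bialgebra equipped with two quasi-antipodes $(S,\alpha,\beta)$ and $(\tilde S,\tilde\alpha,\tilde\beta)$, and let $$v=\sum_\nu \tilde S(X_\nu)\,\tilde\alpha\, Y_\nu\,\beta\, S(Z_\nu),\qquad \Phi=\sum_\nu X_\nu\otimes Y_\nu\otimes Z_\nu .$$ Then $v$ is universal, i.e. invariant under twisting: for every twist $F\in H\otimes H$, writing $\Phi_F=\sum_\nu X^F_\nu\otimes Y^F_\nu\otimes Z^F_\nu$, the operator $$v_F=\sum_\nu \tilde S(X^F_\nu)\,\tilde\alpha_F\, Y^F_\nu\,\beta_F\, S(Z^F_\nu)$$ formed from the structure twisted by $F$ satisfies $v_F=v$.
   Context: A quasi-bialgebra $(H,\Delta,\epsilon,\Phi)$ over a field $k$ is a unital associative $k$-algebra $H$ with algebra homomorphisms $\epsilon:H\to k$, $\Delta:H\to H\otimes H$ and an invertible $\Phi\in H\otimes H\otimes H$ such that (with $1$ also denoting the identity map) $(1\otimes\Delta)\Delta(a)=\Phi^{-1}(\Delta\otimes 1)\Delta(a)\Phi$ for all $a\in H$; $(\Delta\otimes 1\otimes 1)\Phi\cdot(1\otimes 1\otimes\Delta)\Phi=(\Phi\otimes 1)\cdot(1\otimes\Delta\otimes 1)\Phi\cdot(1\otimes\Phi)$; $(\epsilon\otimes 1)\Delta=1=(1\otimes\epsilon)\Delta$; $(1\otimes\epsilon\otimes 1)\Phi=1$. Write $\Phi=\sum_\nu X_\nu\otimes Y_\nu\otimes Z_\nu$,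 $\Phi^{-1}=\sum_\nu\bar X_\nu\otimes\bar Y_\nu\otimes\bar Z_\nu$, $\Delta(a)=\sum a_{(1)}\otimes a_{(2)}$. A quasi-antipode is a triple $(S,\alpha,\beta)$ with $S:H\to H$ an algebra anti-homomorphism (assumed bijective throughout) and $\alpha,\beta\in H$ such that $\sum S(X_\nu)\alpha Y_\nu\beta S(Z_\nu)=1=\sum\bar X_\nu\beta S(\bar Y_\nu)\alpha\bar Z_\nu$ and $\sum S(a_{(1)})\alpha a_{(2)}=\epsilon(a)\alpha$, $\sum a_{(1)}\beta S(a_{(2)})=\epsilon(a)\beta$ for all $a\in H$. (The element $v$ is the unique invertible element of $H$ with $v\alpha=\tilde\alpha$, $\tilde\beta v=\beta$, $\tilde S(a)=vS(a)v^{-1}$ for all $a$.) A twist is an invertible $F\in H\otimes H$ with $(\epsilon\otimes 1)F=(1\otimes\epsilon)F=1$. Write $F=\sum f_i\otimes f^i$, $F^{-1}=\sum\bar f_i\otimes\bar f^i$. The structure twisted by $F$ has the same $\epsilon$ and antipode, and $\Delta_F(a)=F\Delta(a)F^{-1}$, $\Phi_F=(F\otimes 1)\cdot(\Delta\otimes 1)F\cdot\Phi\cdot(1\otimes\Delta)F^{-1}\cdot(1\otimes F^{-1})$, and canonical elements $\alpha_F=\sum S(\bar f_i)\alpha\bar f^i$, $\beta_F=\sum f_i\beta S(f^i)$; for the second quasi-antipode, $\tilde\alpha_F=\sum\tilde S(\bar f_i)\tilde\alpha\bar f^i$, $\tilde\beta_F=\sum f_i\tilde\beta\tilde S(f^i)$.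 *)

theory Defs
  imports Complex_Main "HOL-Library.Poly_Mapping"
begin

section \<open>Free vector spaces\<close>

text \<open>
  \<open>'b \<Rightarrow>\<^sub>0 'k\<close> is the vector space over \<open>'k\<close> with basis \<open>'b\<close>; the basis vector of \<open>b\<close> is
  \<open>Poly_Mapping.single b 1\<close>.
\<close>

definition free_scale :: "'k::field \<Rightarrow> ('b \<Rightarrow>\<^sub>0 'k) \<Rightarrow> ('b \<Rightarrow>\<^sub>0 'k)" where
  "free_scale c p = Poly_Mapping.map ((*) c) p"

lemma lookup_free_scale [simp]:
  "Poly_Mapping.lookup (free_scale c p) b = c * Poly_Mapping.lookup p b"
  unfolding free_scale_def by transfer (auto simp: when_def)

interpretation free: vector_space free_scale
  by unfold_locales (auto intro!: poly_mapping_eqI simp: lookup_add algebra_simps)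

lemma free_scale_single [simp]:
  "free_scale c (Poly_Mapping.single b d) = Poly_Mapping.single b (c * d)"
  by (rule poly_mapping_eqI) (simp add: lookup_single when_def)

definition free_extend ::
  "('k::field \<Rightarrow> 'v \<Rightarrow> 'v::ab_group_add) \<Rightarrow> ('b \<Rightarrow> 'v) \<Rightarrow> ('b \<Rightarrow>\<^sub>0 'k) \<Rightarrow> 'v" where
  "free_extend sc f p = (\<Sum>b\<in>Poly_Mapping.keys p. sc (Poly_Mapping.lookup p b) (f b))"

context vector_space
begin

lemma free_extend_superset:
  assumes "finite B" "Poly_Mapping.keys p \<subseteq> B"
  shows "free_extend scale f p = (\<Sum>b\<in>B. scale (Poly_Mapping.lookup p b) (f b))"
  unfolding free_extend_def
  by (rule sum.mono_neutral_left) (use assms in \<open>auto simp: in_keys_iff\<close>)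

lemma free_extend_add: "free_extend scale f (p + q) = free_extend scale f p + free_extend scale f q"
proof -
  let ?B = "Poly_Mapping.keys p \<union> Poly_Mapping.keys q"
  have "free_extend scale f r = (\<Sum>b\<in>?B. scale (Poly_Mapping.lookup r b) (f b))"
    if "r \<in> {p, q, p + q}" for r
    by (rule free_extend_superset) (use that keys_add[of p q] in auto)
  then show ?thesis
    by (simp add: lookup_add scale_left_distrib sum.distrib)
qed

lemma free_extend_scale: "free_extend scale f (free_scale c p) = scale c (free_extend scale f p)"
proof -
  have "free_extend scale f r = (\<Sum>b\<in>Poly_Mapping.keys p. scale (Poly_Mapping.lookup r b) (f b))"
    if "r \<in> {p, free_scale c p}" for r
    by (rule free_extend_superset) (use that in \<open>auto simp: in_keys_iff\<close>)
  then show ?thesis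
    by (simp add: scale_sum_right)
qed

lemma free_extend_0 [simp]: "free_extend scale f 0 = 0"
  by (simp add: free_extend_def)

lemma free_extend_single [simp]: "free_extend scale f (Poly_Mapping.single b c) = scale c (f b)"
  by (cases "c = 0") (simp_all add: free_extend_def)

lemma free_extend_diff: "free_extend scale f (p - q) = free_extend scale f p - free_extend scale f q"
  using free_extend_add[of f "p - q" q] by simp

lemma free_extend_sum: "free_extend scale f (sum g I) = (\<Sum>i\<in>I. free_extend scale f (g i))"
  by (induction I rule: infinite_finite_induct) (simp_all add: free_extend_add)

end


section \<open>Tensor powers of an algebra\<close>

text \<open>
  All tensor powers of \<open>H\<close> live in the quotient of the free vector space on words
  \<open>[x\<^sub>1, \<dots>, x\<^sub>n]\<close> by the subspace that makes \<open>[x\<^sub>1, \<dots>, x\<^sub>n]\<close> multilinear.  The relators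
  are homogeneous in the length of words, so this quotient is the direct sum of the spaces
  \<open>H\<^sup>\<otimes>\<^sup>n\<close> (where \<open>H\<^sup>\<otimes>\<^sup>0\<close> is the ground field).  The subspace depends on the scalar
  multiplication, which is a term, so the quotient is formed by cosets rather than as a type.
\<close>

type_synonym ('k, 'a) tensor = "('a list \<Rightarrow>\<^sub>0 'k) set"

locale assoc_algebra = vector_space scale
  for scale :: "'k::field \<Rightarrow> 'a::ring_1 \<Rightarrow> 'a" +
  assumes scale_mult_left: "scale c x * y = scale c (x * y)"
    and scale_mult_right: "x * scale c y = scale c (x * y)"
begin

definition relators :: "('a list \<Rightarrow>\<^sub>0 'k) set" where
  "relators =
     {Poly_Mapping.single (xs @ (x + y) # ys) 1
        - Poly_Mapping.single (xs @ x # ys) 1 - Poly_Mapping.single (xs @ y # ys) 1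
      | xs x y ys. True} \<union>
     {Poly_Mapping.single (xs @ scale c x # ys) 1 - Poly_Mapping.single (xs @ x # ys) c
      | xs c x ys. True}"

definition tensor_class :: "('a list \<Rightarrow>\<^sub>0 'k) \<Rightarrow> ('k, 'a) tensor" where
  "tensor_class p = {q. q - p \<in> free.span relators}"

definition rep :: "('k, 'a) tensor \<Rightarrow> ('a list \<Rightarrow>\<^sub>0 'k)" where
  "rep t = (SOME p. p \<in> t)"

definition tensor_power :: "nat \<Rightarrow> ('k, 'a) tensor set" where
  "tensor_power n = {tensor_class p | p. \<forall>w\<in>Poly_Mapping.keys p. length w = n}"

definition pure :: "'a list \<Rightarrow> ('k, 'a) tensor" where
  "pure w = tensor_class (Poly_Mapping.single w 1)"

definition tensor_zero :: "('k, 'a) tensor" where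
  "tensor_zero = tensor_class 0"

definition tensor_add :: "('k, 'a) tensor \<Rightarrow> ('k, 'a) tensor \<Rightarrow> ('k, 'a) tensor" where
  "tensor_add s t = tensor_class (rep s + rep t)"

definition tensor_scale :: "'k \<Rightarrow> ('k, 'a) tensor \<Rightarrow> ('k, 'a) tensor" where
  "tensor_scale c t = tensor_class (free_scale c (rep t))"

text \<open>
  The linear maps on tensors induced by multilinear functions of words, with values in tensors
  and in \<open>H\<close>.  They do not depend on the chosen representative, see \<open>tensor_lift_class\<close> and
  \<open>tensor_eval_class\<close> below.
\<close>

definition tensor_lift ::
  "('a list \<Rightarrow> ('k, 'a) tensor) \<Rightarrow> ('k, 'a) tensor \<Rightarrow> ('k, 'a) tensor" where
  "tensor_lift g t = tensor_class (free_extend free_scale (\<lambda>w. rep (g w)) (rep t))"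

definition tensor_eval :: "('a list \<Rightarrow> 'a) \<Rightarrow> ('k, 'a) tensor \<Rightarrow> 'a" where
  "tensor_eval g t = free_extend scale g (rep t)"

text \<open>For \<open>t = \<Sum> x\<^sub>i \<otimes> y\<^sub>i\<close>, \<open>eval2 f t\<close> is \<open>\<Sum> f x\<^sub>i y\<^sub>i\<close>; similarly for \<open>eval3\<close>.\<close>

definition eval2 :: "('a \<Rightarrow> 'a \<Rightarrow> 'a) \<Rightarrow> ('k, 'a) tensor \<Rightarrow> 'a" where
  "eval2 f = tensor_eval (\<lambda>w. case w of [x, y] \<Rightarrow> f x y | _ \<Rightarrow> 0)"

definition eval3 :: "('a \<Rightarrow> 'a \<Rightarrow> 'a \<Rightarrow> 'a) \<Rightarrow> ('k, 'a) tensor \<Rightarrow> 'a" where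
  "eval3 f = tensor_eval (\<lambda>w. case w of [x, y, z] \<Rightarrow> f x y z | _ \<Rightarrow> 0)"

definition tensor_cat :: "('k, 'a) tensor \<Rightarrow> ('k, 'a) tensor \<Rightarrow> ('k, 'a) tensor"
    (infixr \<open>\<otimes>\<close> 75) where
  "s \<otimes> t = tensor_lift (\<lambda>v. tensor_lift (\<lambda>w. pure (v @ w)) t) s"

text \<open>The product of the algebra \<open>H\<^sup>\<otimes>\<^sup>n\<close>; tensors of different degrees multiply to \<open>0\<close>.\<close>

definition tensor_mult :: "('k, 'a) tensor \<Rightarrow> ('k, 'a) tensor \<Rightarrow> ('k, 'a) tensor"
    (infixl \<open>\<odot>\<close> 70) where
  "s \<odot> t = tensor_lift (\<lambda>v. tensor_lift
     (\<lambda>w. if length v = length w then pure (map2 (*) v w) else tensor_zero) t) s"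

definition tensor_one :: "nat \<Rightarrow> ('k, 'a) tensor" where
  "tensor_one n = pure (replicate n 1)"

definition tensor_unit :: "nat \<Rightarrow> ('k, 'a) tensor \<Rightarrow> bool" where
  "tensor_unit n t \<longleftrightarrow> t \<in> tensor_power n \<and>
     (\<exists>u\<in>tensor_power n. t \<odot> u = tensor_one n \<and> u \<odot> t = tensor_one n)"

definition tensor_inv :: "nat \<Rightarrow> ('k, 'a) tensor \<Rightarrow> ('k, 'a) tensor" where
  "tensor_inv n t =
     (THE u. u \<in> tensor_power n \<and> t \<odot> u = tensor_one n \<and> u \<odot> t = tensor_one n)"

text \<open>
  \<open>tensor_map [f\<^sub>1, \<dots>, f\<^sub>n]\<close> is the linear map \<open>f\<^sub>1 \<otimes> \<dots> \<otimes> f\<^sub>n\<close> on \<open>H\<^sup>\<otimes>\<^sup>n\<close>, for linear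
  maps \<open>f\<^sub>i\<close> from \<open>H\<close> to tensors of any degrees.  The identity map of \<open>H\<close> is \<open>\<iota>\<close>, and a linear
  form \<open>\<epsilon>\<close> on \<open>H\<close> enters as \<open>scalar \<circ> \<epsilon>\<close>, a map to degree \<open>0\<close>.
\<close>

definition tensor_map ::
  "('a \<Rightarrow> ('k, 'a) tensor) list \<Rightarrow> ('k, 'a) tensor \<Rightarrow> ('k, 'a) tensor" where
  "tensor_map fs = tensor_lift (\<lambda>w. if length w = length fs
     then foldr (\<otimes>) (map2 (\<lambda>f x. f x) fs w) (pure []) else tensor_zero)"

definition inj1 :: "'a \<Rightarrow> ('k, 'a) tensor" (\<open>\<iota>\<close>) where
  "\<iota> x = pure [x]"

definition scalar :: "'k \<Rightarrow> ('k, 'a) tensor" where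
  "scalar c = tensor_class (Poly_Mapping.single [] c)"


subsection \<open>Well-definedness\<close>

lemma tensor_class_eq_iff: "tensor_class p = tensor_class q \<longleftrightarrow> p - q \<in> free.span relators"
proof
  assume "tensor_class p = tensor_class q"
  moreover have "p \<in> tensor_class p"
    by (simp add: tensor_class_def free.span_zero)
  ultimately show "p - q \<in> free.span relators"
    by (simp add: tensor_class_def)
next
  assume *: "p - q \<in> free.span relators"
  have "r - p \<in> free.span relators \<longleftrightarrow> r - q \<in> free.span relators" for r
    using free.span_add[OF _ *, of "r - p"] free.span_diff[OF _ *, of "r - q"] by auto
  then show "tensor_class p = tensor_class q"
    by (simp add: tensor_class_def)
qed

lemma rep_tensor_class: "rep (tensor_class p) - p \<in> free.span relators"
proof -
  have "p \<in> tensor_class p"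
    by (simp add: tensor_class_def free.span_zero)
  then have "rep (tensor_class p) \<in> tensor_class p"
    unfolding rep_def by (rule someI)
  then show ?thesis
    by (simp add: tensor_class_def)
qed

lemma tensor_class_rep [simp]: "tensor_class (rep (tensor_class p)) = tensor_class p"
  by (simp add: tensor_class_eq_iff rep_tensor_class)

lemma tensor_class_add_cong:
  assumes "tensor_class p = tensor_class p'" "tensor_class q = tensor_class q'"
  shows "tensor_class (p + q) = tensor_class (p' + q')"
proof -
  have "p + q - (p' + q') = (p - p') + (q - q')"
    by simp
  then show ?thesis
    using assms free.span_add unfolding tensor_class_eq_iff by metis
qed

lemma tensor_class_scale_cong:
  assumes "tensor_class p = tensor_class p'"
  shows "tensor_class (free_scale c p) = tensor_class (free_scale c p')"
  using assms free.span_scale unfolding tensor_class_eq_iff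
  by (metis free.scale_right_diff_distrib)

lemma tensor_add_class: "tensor_add (tensor_class p) (tensor_class q) = tensor_class (p + q)"
  unfolding tensor_add_def by (rule tensor_class_add_cong) simp_all

lemma tensor_scale_class: "tensor_scale c (tensor_class p) = tensor_class (free_scale c p)"
  unfolding tensor_scale_def by (rule tensor_class_scale_cong) simp

lemma tensor_eval_class:
  assumes g_add: "\<And>xs x y ys. g (xs @ (x + y) # ys) = g (xs @ x # ys) + g (xs @ y # ys)"
    and g_scale: "\<And>xs c x ys. g (xs @ scale c x # ys) = scale c (g (xs @ x # ys))"
  shows "tensor_eval g (tensor_class p) = free_extend scale g p"
proof -
  have "free_extend scale g r = 0" if "r \<in> free.span relators" for r
    using that
  proof (induction rule: free.span_induct_alt)
    case (step c r s)
    have "free_extend scale g r = 0"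
      using step(1) by (auto simp: relators_def free_extend_diff g_add g_scale)
    then show ?case
      using step(2) by (simp add: free_extend_add free_extend_scale)
  qed simp
  from this[OF rep_tensor_class[of p]] show ?thesis
    by (simp add: tensor_eval_def free_extend_diff)
qed

lemma tensor_lift_class:
  assumes g_class: "\<And>w. \<exists>q. g w = tensor_class q"
    and g_add: "\<And>xs x y ys. g (xs @ (x + y) # ys) = tensor_add (g (xs @ x # ys)) (g (xs @ y # ys))"
    and g_scale: "\<And>xs c x ys. g (xs @ scale c x # ys) = tensor_scale c (g (xs @ x # ys))"
  shows "tensor_lift g (tensor_class p) = tensor_class (free_extend free_scale (\<lambda>w. rep (g w)) p)"
proof -
  let ?e = "free_extend free_scale (\<lambda>w. rep (g w))"
  have rep_g: "tensor_class (rep (g w)) = g w" for w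
    using g_class[of w] tensor_class_rep by metis
  have "?e r \<in> free.span relators" if "r \<in> free.span relators" for r
    using that
  proof (induction rule: free.span_induct_alt)
    case base
    show ?case
      by (simp add: free.span_zero)
  next
    case (step c r s)
    have "?e r \<in> free.span relators"
    proof -
      from step(1) consider
        (add) xs x y ys where "r = Poly_Mapping.single (xs @ (x + y) # ys) 1
           - Poly_Mapping.single (xs @ x # ys) 1 - Poly_Mapping.single (xs @ y # ys) 1"
        | (scale) xs c x ys where
           "r = Poly_Mapping.single (xs @ scale c x # ys) 1 - Poly_Mapping.single (xs @ x # ys) c"
        unfolding relators_def by blast
      then show ?thesis
      proof cases
        case add
        have "tensor_class (rep (g (xs @ (x + y) # ys)))
            = tensor_class (rep (g (xs @ x # ys)) + rep (g (xs @ y # ys)))"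
          by (simp only: rep_g g_add) (simp add: tensor_add_def)
        then show ?thesis
          by (simp add: add free.free_extend_diff free.free_extend_add tensor_class_eq_iff diff_diff_eq)
      next
        case scale
        have "tensor_class (rep (g (xs @ scale c x # ys)))
            = tensor_class (free_scale c (rep (g (xs @ x # ys))))"
          by (simp only: rep_g g_scale) (simp add: tensor_scale_def)
        then show ?thesis
          by (simp add: scale free.free_extend_diff tensor_class_eq_iff)
      qed
    qed
    then show ?case
      using step(2)
      by (simp add: free.free_extend_add free.free_extend_scale free.span_add free.span_scale)
  qed
  from this[OF rep_tensor_class[of p]] show ?thesis
    by (simp add: tensor_lift_def free.free_extend_diff tensor_class_eq_iff)
qed

lemma eval2_sum:
  assumes "\<And>x x' y. f (x + x') y = f x y + f x' y" "\<And>x y y'. f x (y + y') = f x y + f x y'"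
    and "\<And>c x y. f (scale c x) y = scale c (f x y)" "\<And>c x y. f x (scale c y) = scale c (f x y)"
  shows "eval2 f (tensor_class (\<Sum>i\<in>I. Poly_Mapping.single [x i, y i] 1)) = (\<Sum>i\<in>I. f (x i) (y i))"
  unfolding eval2_def
  by (subst tensor_eval_class)
    (auto simp: free_extend_sum assms append_eq_Cons_conv Cons_eq_append_conv split: list.split)

lemma eval3_sum:
  assumes "\<And>x x' y z. f (x + x') y z = f x y z + f x' y z"
    and "\<And>x y y' z. f x (y + y') z = f x y z + f x y' z"
    and "\<And>x y z z'. f x y (z + z') = f x y z + f x y z'"
    and "\<And>c x y z. f (scale c x) y z = scale c (f x y z)"
    and "\<And>c x y z. f x (scale c y) z = scale c (f x y z)"
    and "\<And>c x y z. f x y (scale c z) = scale c (f x y z)"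
  shows "eval3 f (tensor_class (\<Sum>i\<in>I. Poly_Mapping.single [x i, y i, z i] 1))
    = (\<Sum>i\<in>I. f (x i) (y i) (z i))"
  unfolding eval3_def
  by (subst tensor_eval_class)
    (auto simp: free_extend_sum assms append_eq_Cons_conv Cons_eq_append_conv split: list.split)


subsection \<open>Operations on pure tensors\<close>

definition multilin :: "('a list \<Rightarrow> ('k, 'a) tensor) \<Rightarrow> bool" where
  "multilin g \<longleftrightarrow> (\<forall>w. \<exists>q. g w = tensor_class q) \<and>
    (\<forall>xs x y ys. g (xs @ (x + y) # ys) = tensor_add (g (xs @ x # ys)) (g (xs @ y # ys))) \<and>
    (\<forall>xs c x ys. g (xs @ scale c x # ys) = tensor_scale c (g (xs @ x # ys)))"

lemma multilin_pure: "multilin pure"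
  unfolding multilin_def
proof (intro conjI allI)
  fix xs x y ys
  show "pure (xs @ (x + y) # ys) = tensor_add (pure (xs @ x # ys)) (pure (xs @ y # ys))"
    unfolding pure_def tensor_add_class tensor_class_eq_iff diff_diff_eq[symmetric]
    by (rule free.span_base) (unfold relators_def, blast)
next
  fix xs c x ys
  show "pure (xs @ scale c x # ys) = tensor_scale c (pure (xs @ x # ys))"
    unfolding pure_def tensor_scale_class tensor_class_eq_iff free_scale_single mult_1_right
    by (rule free.span_base) (unfold relators_def, blast)
qed (auto simp: pure_def)

lemma tensor_lift_pure:
  assumes "multilin g" shows "tensor_lift g (pure w) = g w"
proof -
  have "tensor_lift g (pure w) = tensor_class (free_extend free_scale (\<lambda>w. rep (g w)) (Poly_Mapping.single w 1))"
    unfolding pure_def by (rule tensor_lift_class) (use assms in \<open>unfold multilin_def, blast+\<close>)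
  then show ?thesis using assms tensor_class_rep unfolding multilin_def by (metis free.free_extend_single free.scale_one)
qed

lemma free_extend_cong:
  assumes "\<And>w. tensor_class (F w) = tensor_class (G w)"
  shows "tensor_class (free_extend free_scale F p) = tensor_class (free_extend free_scale G p)"
proof -
  have "free_extend free_scale F p - free_extend free_scale G p = (\<Sum>b\<in>Poly_Mapping.keys p. free_scale (Poly_Mapping.lookup p b) (F b - G b))"
    unfolding free_extend_def by (simp add: sum_subtractf free.scale_right_diff_distrib)
  then show ?thesis using assms unfolding tensor_class_eq_iff
    by (simp add: free.span_sum free.span_scale)
qed

lemma multilin_lift:
  assumes h: "\<And>w. multilin (\<lambda>v. h v w)"
  shows "multilin (\<lambda>v. tensor_lift (h v) t)"
proof -
  have cl: "tensor_class (rep (h v w)) = h v w" for v w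
    using h tensor_class_rep unfolding multilin_def by metis
  have A: "h (xs @ (x + y) # ys) w = tensor_add (h (xs @ x # ys) w) (h (xs @ y # ys) w)"
   and B: "h (xs @ scale c x # ys) w = tensor_scale c (h (xs @ x # ys) w)" for xs x y ys w c
    using h unfolding multilin_def by blast+
  have add: "free_extend free_scale (\<lambda>w. F w + G w) p = free_extend free_scale F p + free_extend free_scale G p" 
   for F G and p :: "'a list \<Rightarrow>\<^sub>0 'k"
    unfolding free_extend_def by (simp add: free.scale_right_distrib sum.distrib)
  have sc: "free_extend free_scale (\<lambda>w. free_scale c (F w)) p = free_scale c (free_extend free_scale F p)" 
   for c F and p :: "'a list \<Rightarrow>\<^sub>0 'k"
    unfolding free_extend_def by (simp add: free.scale_sum_right mult.commute)
  show ?thesis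
    unfolding multilin_def
  proof (intro conjI allI)
    fix w show "\<exists>q. tensor_lift (h w) t = tensor_class q" unfolding tensor_lift_def by blast
  next
    fix xs x y ys
    show "tensor_lift (h (xs @ (x + y) # ys)) t =
       tensor_add (tensor_lift (h (xs @ x # ys)) t) (tensor_lift (h (xs @ y # ys)) t)"
      unfolding tensor_lift_def tensor_add_class add[symmetric]
      by (rule free_extend_cong) (metis cl A tensor_add_def)
  next
    fix xs c x ys
    show "tensor_lift (h (xs @ scale c x # ys)) t = tensor_scale c (tensor_lift (h (xs @ x # ys)) t)"
      unfolding tensor_lift_def tensor_scale_class sc[symmetric]
      by (rule free_extend_cong) (metis cl B tensor_scale_def)
  qed
qed

lemma multilin_cat1: "multilin (\<lambda>w. pure (v @ w))"
  and multilin_cat2: "multilin (\<lambda>v. pure (v @ w))"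
  using multilin_pure unfolding multilin_def by (simp_all flip: append_assoc) (metis append_assoc append_Cons)+

lemma tensor_cat_pure: "pure v \<otimes> pure w = pure (v @ w)"
  unfolding tensor_cat_def by (simp add: tensor_lift_pure multilin_lift multilin_cat1 multilin_cat2)

lemma tensor_zero_ops: "tensor_add tensor_zero tensor_zero = tensor_zero" "tensor_scale c tensor_zero = tensor_zero"
  by (simp_all add: tensor_zero_def tensor_add_class tensor_scale_class)

lemma map2_split:
  assumes "length v = Suc (length xs + length ys)"
  obtains u z u' where "v = u @ z # u'" "length u = length xs" "length u' = length ys"
proof -
  have "v = take (length xs) v @ v ! length xs # drop (Suc (length xs)) v"
    using assms by (simp add: id_take_nth_drop)
  then show ?thesis using that assms by (metis Suc_eq_plus1 add.commute add_diff_cancel_left' diff_Suc_Suc length_drop length_take less_add_Suc1 min.absorb4 plus_1_eq_Suc)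
qed

lemma multilin_mult1: "multilin (\<lambda>w. if length v = length w then pure (map2 (*) v w) else tensor_zero)"
  unfolding multilin_def
proof (intro conjI allI)
  fix w show "\<exists>q. (if length v = length w then pure (map2 (*) v w) else tensor_zero) = tensor_class q"
    unfolding pure_def tensor_zero_def by auto
qed (auto elim!: map2_split simp: tensor_zero_ops distrib_left scale_mult_right 
      multilin_pure[unfolded multilin_def])

lemma multilin_mult2: "multilin (\<lambda>v. if length v = length w then pure (map2 (*) v w) else tensor_zero)"
  unfolding multilin_def
proof (intro conjI allI)
  fix v show "\<exists>q. (if length v = length w then pure (map2 (*) v w) else tensor_zero) = tensor_class q"
    unfolding pure_def tensor_zero_def by auto
qed (auto elim!: map2_split[OF sym] simp: tensor_zero_ops distrib_right scale_mult_left
      multilin_pure[unfolded multilin_def])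

lemma tensor_mult_pure: "pure v \<odot> pure w = (if length v = length w then pure (map2 (*) v w) else tensor_zero)"
  unfolding tensor_mult_def 
  by (subst tensor_lift_pure, intro multilin_lift multilin_mult2) (subst tensor_lift_pure, intro multilin_mult1, simp)

end


section \<open>Quasi-bialgebras, quasi-antipodes and twists\<close>

locale quasi_bialgebra = assoc_algebra scale
  for scale :: "'k::field \<Rightarrow> 'a::ring_1 \<Rightarrow> 'a" +
  fixes \<Delta> :: "'a \<Rightarrow> ('k, 'a) tensor"
    and \<epsilon> :: "'a \<Rightarrow> 'k"
    and \<Phi> :: "('k, 'a) tensor"
  assumes counit_add: "\<epsilon> (a + b) = \<epsilon> a + \<epsilon> b"
    and counit_scale: "\<epsilon> (scale c a) = c * \<epsilon> a"
    and counit_mult: "\<epsilon> (a * b) = \<epsilon> a * \<epsilon> b"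
    and counit_one: "\<epsilon> 1 = 1"
    and coprod_range: "\<Delta> a \<in> tensor_power 2"
    and coprod_add: "\<Delta> (a + b) = tensor_add (\<Delta> a) (\<Delta> b)"
    and coprod_scale: "\<Delta> (scale c a) = tensor_scale c (\<Delta> a)"
    and coprod_mult: "\<Delta> (a * b) = \<Delta> a \<odot> \<Delta> b"
    and coprod_one: "\<Delta> 1 = tensor_one 2"
    and associator_unit: "tensor_unit 3 \<Phi>"
    and quasi_coassoc: "tensor_map [\<iota>, \<Delta>] (\<Delta> a) = tensor_inv 3 \<Phi> \<odot> tensor_map [\<Delta>, \<iota>] (\<Delta> a) \<odot> \<Phi>"
    and pentagon: "tensor_map [\<Delta>, \<iota>, \<iota>] \<Phi> \<odot> tensor_map [\<iota>, \<iota>, \<Delta>] \<Phi> =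
           (\<Phi> \<otimes> \<iota> 1) \<odot> tensor_map [\<iota>, \<Delta>, \<iota>] \<Phi> \<odot> (\<iota> 1 \<otimes> \<Phi>)"
    and counit_left: "tensor_map [scalar \<circ> \<epsilon>, \<iota>] (\<Delta> a) = \<iota> a"
    and counit_right: "tensor_map [\<iota>, scalar \<circ> \<epsilon>] (\<Delta> a) = \<iota> a"
    and counit_associator: "tensor_map [\<iota>, scalar \<circ> \<epsilon>, \<iota>] \<Phi> = tensor_one 2"

locale quasi_antipode = quasi_bialgebra scale \<Delta> \<epsilon> \<Phi>
  for scale :: "'k::field \<Rightarrow> 'a::ring_1 \<Rightarrow> 'a"
    and \<Delta> :: "'a \<Rightarrow> ('k, 'a) tensor"
    and \<epsilon> :: "'a \<Rightarrow> 'k"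
    and \<Phi> :: "('k, 'a) tensor" +
  fixes S :: "'a \<Rightarrow> 'a"
    and \<alpha> \<beta> :: 'a
  assumes antipode_add: "S (a + b) = S a + S b"
    and antipode_scale: "S (scale c a) = scale c (S a)"
    and antipode_mult: "S (a * b) = S b * S a"
    and antipode_one: "S 1 = 1"
    and antipode_bij: "bij S"
    and antipode_associator: "eval3 (\<lambda>x y z. S x * \<alpha> * y * \<beta> * S z) \<Phi> = 1"
    and antipode_associator_inv:
      "eval3 (\<lambda>x y z. x * \<beta> * S y * \<alpha> * z) (tensor_inv 3 \<Phi>) = 1"
    and antipode_left: "eval2 (\<lambda>x y. S x * \<alpha> * y) (\<Delta> a) = scale (\<epsilon> a) \<alpha>"
    and antipode_right: "eval2 (\<lambda>x y. x * \<beta> * S y) (\<Delta> a) = scale (\<epsilon> a) \<beta>"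

context assoc_algebra
begin

definition is_twist :: "('a \<Rightarrow> 'k) \<Rightarrow> ('k, 'a) tensor \<Rightarrow> bool" where
  "is_twist \<epsilon> F \<longleftrightarrow> tensor_unit 2 F \<and>
     tensor_map [scalar \<circ> \<epsilon>, \<iota>] F = \<iota> 1 \<and> tensor_map [\<iota>, scalar \<circ> \<epsilon>] F = \<iota> 1"

text \<open>
  The twisted structure has the coproduct \<open>twist_coprod\<close>, the associator \<open>twist_associator\<close>,
  and the same counit and antipode maps; the first of these does not enter \<open>comparison\<close>.
\<close>

definition twist_coprod ::
  "('k, 'a) tensor \<Rightarrow> ('a \<Rightarrow> ('k, 'a) tensor) \<Rightarrow> 'a \<Rightarrow> ('k, 'a) tensor" where
  "twist_coprod F \<Delta> a = F \<odot> \<Delta> a \<odot> tensor_inv 2 F"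

definition twist_associator ::
  "('k, 'a) tensor \<Rightarrow> ('a \<Rightarrow> ('k, 'a) tensor) \<Rightarrow> ('k, 'a) tensor \<Rightarrow> ('k, 'a) tensor" where
  "twist_associator F \<Delta> \<Phi> =
     (F \<otimes> \<iota> 1) \<odot> tensor_map [\<Delta>, \<iota>] F \<odot> \<Phi> \<odot>
     tensor_map [\<iota>, \<Delta>] (tensor_inv 2 F) \<odot> (\<iota> 1 \<otimes> tensor_inv 2 F)"

definition twist_alpha :: "('k, 'a) tensor \<Rightarrow> ('a \<Rightarrow> 'a) \<Rightarrow> 'a \<Rightarrow> 'a" where
  "twist_alpha F S \<alpha> = eval2 (\<lambda>x y. S x * \<alpha> * y) (tensor_inv 2 F)"

definition twist_beta :: "('k, 'a) tensor \<Rightarrow> ('a \<Rightarrow> 'a) \<Rightarrow> 'a \<Rightarrow> 'a" where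
  "twist_beta F S \<beta> = eval2 (\<lambda>x y. x * \<beta> * S y) F"

text \<open>
  The element comparing a quasi-antipode \<open>(S, \<alpha>, \<beta>)\<close> with a second one \<open>(S', \<alpha>', \<beta>')\<close>;
  \<open>\<alpha>\<close> and \<open>\<beta>'\<close> do not enter.
\<close>

definition comparison ::
  "('k, 'a) tensor \<Rightarrow> ('a \<Rightarrow> 'a) \<Rightarrow> 'a \<Rightarrow> ('a \<Rightarrow> 'a) \<Rightarrow> 'a \<Rightarrow> 'a" where
  "comparison \<Phi> S \<beta> S' \<alpha>' = eval3 (\<lambda>x y z. S' x * \<alpha>' * y * \<beta> * S z) \<Phi>"

end

end

theory Submission
  imports Defs
begin

text \<open>
  Write \<open>F\<^sup>-\<^sup>1 = \<Sum> g \<otimes> g'\<close>.  The twisted associator is \<open>\<Phi>\<close> multiplied on each side by two factors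
  built from \<open>F\<close> or \<open>F\<^sup>-\<^sup>1\<close>, and the form \<open>S' x * u * y * w * S z\<close> that defines the comparison element
  absorbs these factors one at a time, from the outside inwards.

  The outermost factors undo the twisting of the canonical elements.  Because \<open>S'\<close> reverses products,
  the left factor \<open>F \<otimes> 1\<close> replaces the middle element \<open>\<alpha>'\<^sub>F = \<Sum> S' g * \<alpha>' * g'\<close> by the sum of
  \<open>S' (g f) * \<alpha>' * (g' f')\<close> over \<open>F\<^sup>-\<^sup>1 F = 1\<close>, which is \<open>\<alpha>'\<close> (\<open>comparison_absorb_twist_left\<close>); in the
  same way \<open>1 \<otimes> F\<^sup>-\<^sup>1\<close> on the right turns \<open>\<beta>\<^sub>F\<close> back into \<open>\<beta>\<close> (\<open>comparison_absorb_twist_right\<close>).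

  The inner factors contain a coproduct, which now meets the original \<open>\<alpha>'\<close> or \<open>\<beta>\<close>.  The antipode
  axioms \<open>\<Sum> S' a\<^sub>1 * \<alpha>' * a\<^sub>2 = \<epsilon> a * \<alpha>'\<close> and \<open>\<Sum> a\<^sub>1 * \<beta> * S a\<^sub>2 = \<epsilon> a * \<beta>\<close> collapse it to a counit, and
  the remaining leg of the factor becomes \<open>(\<epsilon> \<otimes> 1) F = 1\<close> on the left and \<open>(1 \<otimes> \<epsilon>) F\<^sup>-\<^sup>1 = 1\<close> on the
  right (\<open>comparison_absorb_coprod_left\<close>, \<open>comparison_absorb_coprod_right\<close>).  What is left is the form
  at \<open>\<Phi>\<close>.

  Sweedler notation is made precise by evaluating multilinear forms on tensors: \<open>eval3 f t\<close> stands for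
  \<open>\<Sum> f x y z\<close> with \<open>t = \<Sum> x \<otimes> y \<otimes> z\<close>.  Evaluating a form on a tensor that is itself obtained by a lift
  amounts to evaluating pointwise (\<open>tensor_eval_lift\<close>).  From this single fact follow the rules that
  rewrite the evaluation of a product, of \<open>t \<otimes> 1\<close> or of \<open>(\<Delta> \<otimes> 1) t\<close> as an iterated evaluation, and
  iterated evaluations may be interchanged because they are finite sums.
\<close>


section \<open>Evaluating multilinear forms on tensors\<close>

context assoc_algebra
begin

definition multilinear_form :: "('a list \<Rightarrow> 'a) \<Rightarrow> bool" where
  "multilinear_form \<phi> \<longleftrightarrow>
     (\<forall>xs x y ys. \<phi> (xs @ (x + y) # ys) = \<phi> (xs @ x # ys) + \<phi> (xs @ y # ys)) \<and>
     (\<forall>xs c x ys. \<phi> (xs @ scale c x # ys) = scale c (\<phi> (xs @ x # ys)))"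

text \<open>
  A linear extension commutes with the finite sum that makes up another linear extension.  This is
  the reason why evaluating a lifted tensor can be done pointwise.
\<close>

lemma free_extend_free_extend:
  "free_extend scale f (free_extend free_scale g p) = free_extend scale (\<lambda>b. free_extend scale f (g b)) p"
  by (simp add: free_extend_def[of free_scale] free_extend_sum free_extend_scale)
     (simp add: free_extend_def[of scale "\<lambda>b. free_extend scale f (g b)"])

lemma free_free_extend_free_extend:
  "free_extend free_scale f (free_extend free_scale g p)
     = free_extend free_scale (\<lambda>b. free_extend free_scale f (g b)) p"
  by (simp add: free_extend_def[of free_scale g] free.free_extend_sum free.free_extend_scale)
     (simp add: free_extend_def[of free_scale "\<lambda>b. free_extend free_scale f (g b)"])

lemma tensor_eval_tensor_class:
  assumes "multilinear_form \<phi>"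
  shows "tensor_eval \<phi> (tensor_class p) = free_extend scale \<phi> p"
  by (rule tensor_eval_class) (use assms in \<open>auto simp: multilinear_form_def\<close>)

lemma tensor_eval_pure: "multilinear_form \<phi> \<Longrightarrow> tensor_eval \<phi> (pure w) = \<phi> w"
  by (simp add: pure_def tensor_eval_tensor_class)

lemma tensor_eval_scalar: "multilinear_form \<phi> \<Longrightarrow> tensor_eval \<phi> (scalar c) = scale c (\<phi> [])"
  by (simp add: scalar_def tensor_eval_tensor_class)

lemma tensor_eval_zero: "multilinear_form \<phi> \<Longrightarrow> tensor_eval \<phi> tensor_zero = 0"
  by (simp add: tensor_zero_def tensor_eval_tensor_class)

text \<open>
  Since \<open>\<phi>\<close> is multilinear, the class formed by the lift may be evaluated at the linear combination
  that represents it.  The right-hand side is the same sum over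
  \<open>rep t\<close>, with the form applied to each summand.
\<close>

lemma tensor_eval_lift:
  assumes "multilinear_form \<phi>"
  shows "tensor_eval \<phi> (tensor_lift g t) = tensor_eval (\<lambda>w. tensor_eval \<phi> (g w)) t"
  by (simp add: tensor_lift_def tensor_eval_tensor_class[OF assms] free_extend_free_extend)
     (simp add: tensor_eval_def)

lemma tensor_eval_linear:
  assumes "\<And>x y. h (x + y) = h x + h y" "\<And>c x. h (scale c x) = scale c (h x)"
  shows "h (tensor_eval \<phi> t) = tensor_eval (\<lambda>w. h (\<phi> w)) t"
proof -
  have "h 0 = 0"
    using assms(2)[of 0 0] by simp
  then have "h (sum g I) = (\<Sum>i\<in>I. h (g i))" for g :: "'a list \<Rightarrow> 'a" and I
    by (induction I rule: infinite_finite_induct) (simp_all add: assms)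
  then show ?thesis by (simp add: tensor_eval_def free_extend_def assms)
qed

lemma tensor_eval_swap:
  "tensor_eval (\<lambda>v. tensor_eval (\<lambda>w. \<phi> v w) t) s = tensor_eval (\<lambda>w. tensor_eval (\<lambda>v. \<phi> v w) s) t"
  by (simp add: tensor_eval_def free_extend_def scale_sum_right mult.commute)
     (rule sum.swap)

lemma tensor_eval_const_zero: "tensor_eval (\<lambda>w. 0) t = 0"
  by (simp add: tensor_eval_def free_extend_def)

lemma multilinear_form_append_left: "multilinear_form \<phi> \<Longrightarrow> multilinear_form (\<lambda>w. \<phi> (v @ w))"
  unfolding multilinear_form_def by (simp flip: append_assoc)

lemma multilinear_form_append_right: "multilinear_form \<phi> \<Longrightarrow> multilinear_form (\<lambda>w. \<phi> (w @ v))"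
  unfolding multilinear_form_def by simp

lemma tensor_eval_cat:
  assumes "multilinear_form \<phi>"
  shows "tensor_eval \<phi> (s \<otimes> t) = tensor_eval (\<lambda>v. tensor_eval (\<lambda>w. \<phi> (v @ w)) t) s"
  by (simp add: tensor_cat_def tensor_eval_lift tensor_eval_pure assms)

lemma tensor_eval_mult:
  assumes "multilinear_form \<phi>"
  shows "tensor_eval \<phi> (s \<odot> t) = tensor_eval (\<lambda>v. tensor_eval
    (\<lambda>w. if length v = length w then \<phi> (map2 (*) v w) else 0) t) s"
  by (simp add: tensor_mult_def tensor_eval_lift tensor_eval_pure tensor_eval_zero assms if_distrib
      cong: if_cong)


section \<open>The algebra of tensors of a fixed degree\<close>

lemma tensor_lift_tensor_class:
  assumes "multilin g"
  shows "tensor_lift g (tensor_class p) = tensor_class (free_extend free_scale (\<lambda>w. rep (g w)) p)"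
  by (rule tensor_lift_class) (use assms in \<open>unfold multilin_def, blast+\<close>)

lemma tensor_lift_lift:
  assumes "multilin g"
  shows "tensor_lift g (tensor_lift h t) = tensor_lift (\<lambda>w. tensor_lift g (h w)) t"
  unfolding tensor_lift_def[of h] tensor_lift_tensor_class[OF assms] free_free_extend_free_extend
  unfolding tensor_lift_def[of _ t]
  by (rule free_extend_cong) (simp add: tensor_lift_def)

lemma tensor_lift_zero: "multilin g \<Longrightarrow> tensor_lift g tensor_zero = tensor_zero"
  by (simp add: tensor_zero_def tensor_lift_tensor_class)

lemma tensor_lift_const_zero: "tensor_lift (\<lambda>w. tensor_zero) t = tensor_zero"
  unfolding tensor_lift_def tensor_zero_def
  by (rule trans[OF free_extend_cong[where G = "\<lambda>w. 0"]]) (simp_all add: free_extend_def)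

text \<open>
  Both sides are iterated lifts of the threefold entrywise product of words.  Words of different
  lengths contribute \<open>0\<close> on either side.
\<close>

lemma tensor_mult_assoc: "(r \<odot> s) \<odot> t = r \<odot> (s \<odot> t)"
proof -
  let ?m = "\<lambda>v w. if length v = length w then pure (map2 (*) v w) else tensor_zero"
  have m: "multilin (\<lambda>v. tensor_lift (?m v) t)"
    by (intro multilin_lift multilin_mult2)
  have assoc: "map2 (*) (map2 (*) u v) w = map2 (*) u (map2 (*) v w)" for u v w :: "'a list"
    by (rule nth_equalityI) (simp_all add: mult.assoc)
  have lift_m: "tensor_lift (?m u) (?m v w) = (if length v = length w then ?m u (map2 (*) v w) else tensor_zero)" for u v w
    by (simp only: if_distrib tensor_lift_pure[OF multilin_mult1] tensor_lift_zero[OF multilin_mult1] cong: if_cong)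
  have inner: "tensor_lift (\<lambda>w. tensor_lift (?m w) t) (?m u v) = tensor_lift (\<lambda>w. tensor_lift (?m u) (?m v w)) t" for u v
    unfolding lift_m
    by (cases "length u = length v")
       (auto simp: tensor_lift_pure[OF m] tensor_lift_zero[OF m] assoc tensor_lift_const_zero
          cong: if_cong intro!: arg_cong[where f = "\<lambda>g. tensor_lift g t"]
          trans[OF tensor_lift_const_zero[symmetric, of t]])
  show ?thesis
    unfolding tensor_mult_def tensor_lift_lift[OF m] tensor_lift_lift[OF multilin_mult1]
    by (simp only: inner)
qed

lemma free_extend_single_one: "free_extend free_scale (\<lambda>w. Poly_Mapping.single w 1) p = p"
  by (rule poly_mapping_eqI)
     (auto simp: free_extend_def lookup_sum lookup_single when_def in_keys_iff)

lemma multilin_graded_pure: "multilin (\<lambda>w. if length w = n then pure w else tensor_zero)"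
  using multilin_pure unfolding multilin_def
  by (auto simp: tensor_zero_ops) (auto simp: tensor_zero_def)

text \<open>
  The function lifted here is what remains of the product of words when one factor is a word of ones.
\<close>

lemma tensor_lift_graded_pure:
  assumes "t \<in> tensor_power n"
  shows "tensor_lift (\<lambda>w. if length w = n then pure w else tensor_zero) t = t"
proof -
  obtain p where p: "t = tensor_class p" "\<And>w. w \<in> Poly_Mapping.keys p \<Longrightarrow> length w = n"
    using assms by (auto simp: tensor_power_def)
  let ?g = "\<lambda>w. if length w = n then pure w else tensor_zero"
  let ?r = "\<lambda>w. if length w = n then Poly_Mapping.single w 1 else 0"
  have "tensor_class (rep (?g w)) = tensor_class (?r w)" for w
    by (simp add: pure_def tensor_zero_def)
  then have "tensor_lift ?g t = tensor_class (free_extend free_scale ?r p)"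
    unfolding p(1) tensor_lift_tensor_class[OF multilin_graded_pure] by (rule free_extend_cong)
  also have "free_extend free_scale ?r p = free_extend free_scale (\<lambda>w. Poly_Mapping.single w 1) p"
    unfolding free_extend_def by (rule sum.cong) (simp_all add: p(2))
  finally show ?thesis by (simp add: p(1) free_extend_single_one)
qed

lemma tensor_one_mult:
  assumes "t \<in> tensor_power n"
  shows "tensor_one n \<odot> t = t" and "t \<odot> tensor_one n = t"
proof -
  let ?m = "\<lambda>v w. if length v = length w then pure (map2 (*) v w) else tensor_zero"
  let ?e = "replicate n (1 :: 'a)"
  have unit: "map2 (*) ?e w = w" "map2 (*) w ?e = w" if "length w = n" for w :: "'a list"
    using that by (auto intro: nth_equalityI)
  have "?m ?e w = (if length w = n then pure w else tensor_zero)"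
    and "?m w ?e = (if length w = n then pure w else tensor_zero)" for w
    by (auto simp: unit)
  then show "tensor_one n \<odot> t = t" "t \<odot> tensor_one n = t"
    using tensor_lift_graded_pure[OF assms]
    by (simp_all only: tensor_one_def tensor_mult_def
        tensor_lift_pure[OF multilin_mult1] tensor_lift_pure[OF multilin_lift[OF multilin_mult2]])
qed

lemma tensor_inv_mult:
  assumes "tensor_unit n t"
  shows "t \<odot> tensor_inv n t = tensor_one n" "tensor_inv n t \<odot> t = tensor_one n"
proof -
  have "\<exists>!u. u \<in> tensor_power n \<and> t \<odot> u = tensor_one n \<and> u \<odot> t = tensor_one n"
    using assms unfolding tensor_unit_def by (metis tensor_mult_assoc tensor_one_mult)
  from theI'[OF this] show "t \<odot> tensor_inv n t = tensor_one n" "tensor_inv n t \<odot> t = tensor_one n"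
    by (simp_all add: tensor_inv_def)
qed


section \<open>Rules for Sweedler sums of two and three factors\<close>

definition bilinear :: "('a \<Rightarrow> 'a \<Rightarrow> 'a) \<Rightarrow> bool" where
  "bilinear f \<longleftrightarrow>
     (\<forall>x x' y. f (x + x') y = f x y + f x' y) \<and> (\<forall>x y y'. f x (y + y') = f x y + f x y') \<and>
     (\<forall>c x y. f (scale c x) y = scale c (f x y)) \<and> (\<forall>c x y. f x (scale c y) = scale c (f x y))"

definition trilinear :: "('a \<Rightarrow> 'a \<Rightarrow> 'a \<Rightarrow> 'a) \<Rightarrow> bool" where
  "trilinear f \<longleftrightarrow> (\<forall>z. bilinear (\<lambda>x y. f x y z)) \<and> (\<forall>x. bilinear (f x))"

lemma trilinear_shift_left:
  "trilinear f \<Longrightarrow> trilinear (\<lambda>a b c. f (a * x) (b * y) (c * z))"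
  by (simp add: trilinear_def bilinear_def algebra_simps scale_mult_left)

lemma trilinear_shift_right:
  "trilinear f \<Longrightarrow> trilinear (\<lambda>a b c. f (x * a) (y * b) (z * c))"
  by (simp add: trilinear_def bilinear_def algebra_simps scale_mult_right)

lemma multilinear_form_singleton: "multilinear_form (\<lambda>w. case w of [x] \<Rightarrow> x | _ \<Rightarrow> 0)"
  by (auto simp: multilinear_form_def append_eq_Cons_conv Cons_eq_append_conv split: list.split)

lemma multilinear_form_pair:
  assumes "bilinear f" shows "multilinear_form (\<lambda>w. case w of [x, y] \<Rightarrow> f x y | _ \<Rightarrow> 0)"
  using assms
  by (auto simp: multilinear_form_def bilinear_def append_eq_Cons_conv Cons_eq_append_conv split: list.split)

lemma multilinear_form_triple:
  assumes "trilinear f" shows "multilinear_form (\<lambda>w. case w of [x, y, z] \<Rightarrow> f x y z | _ \<Rightarrow> 0)"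
  using assms
  by (auto simp: multilinear_form_def trilinear_def bilinear_def append_eq_Cons_conv Cons_eq_append_conv split: list.split)

lemma eval2_linear:
  assumes "\<And>x y. h (x + y) = h x + h y" "\<And>c x. h (scale c x) = scale c (h x)"
  shows "h (eval2 f t) = eval2 (\<lambda>x y. h (f x y)) t"
proof -
  have "h 0 = 0" using assms(2)[of 0 0] by simp
  then show ?thesis
    unfolding eval2_def by (subst tensor_eval_linear[of h])
      (auto simp: assms intro!: arg_cong[where f = "\<lambda>\<phi>. tensor_eval \<phi> t"] split: list.split)
qed

text \<open>
  Read from left to right the rule pulls constant factors out of a Sweedler sum.  Both factors are
  always present, so that the left-hand side is a higher-order pattern; a missing one is supplied as \<open>1\<close>.
\<close>

lemma eval2_times: "eval2 (\<lambda>x y. a * f x y * b) t = a * eval2 f t * b"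
  by (rule eval2_linear[symmetric]) (simp_all add: algebra_simps scale_mult_left scale_mult_right)

lemma eval2_one: "bilinear f \<Longrightarrow> eval2 f (tensor_one 2) = f 1 1"
  by (simp add: eval2_def tensor_one_def tensor_eval_pure multilinear_form_pair numeral_2_eq_2)

lemma eval2_mult:
  assumes "bilinear f"
  shows "eval2 f (s \<odot> t) = eval2 (\<lambda>a b. eval2 (\<lambda>x y. f (a * x) (b * y)) t) s"
proof -
  have "(\<lambda>w. if length v = length w then case map2 (*) v w of [x, y] \<Rightarrow> f x y | _ \<Rightarrow> 0 else 0)
      = (case v of [a, b] \<Rightarrow> (\<lambda>w. case w of [x, y] \<Rightarrow> f (a * x) (b * y) | _ \<Rightarrow> 0) | _ \<Rightarrow> (\<lambda>w. 0))" for v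
    by (auto simp: fun_eq_iff Suc_length_conv length_Suc_conv split: list.split)
  then show ?thesis
    unfolding eval2_def tensor_eval_mult[OF multilinear_form_pair[OF assms]]
    by (auto simp: tensor_eval_const_zero intro!: arg_cong[where f = "\<lambda>\<phi>. tensor_eval \<phi> s"]
        split: list.split)
qed

lemma eval2_swap:
  "eval2 (\<lambda>a b. eval2 (\<lambda>x y. f a b x y) t) s = eval2 (\<lambda>x y. eval2 (\<lambda>a b. f a b x y) s) t"
proof -
  \<comment> \<open>The case distinction on the outer word moves inside the inner evaluation, so that
    \<open>tensor_eval_swap\<close> applies to plain nested evaluations.\<close>
  have pull: "(case v of [a, b] \<Rightarrow> tensor_eval (\<phi> a b) r | _ \<Rightarrow> 0)
      = tensor_eval (\<lambda>w. case v of [a, b] \<Rightarrow> \<phi> a b w | _ \<Rightarrow> 0) r" for v and \<phi> :: "'a \<Rightarrow> 'a \<Rightarrow> 'a list \<Rightarrow> 'a" and r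
    by (auto simp: tensor_eval_const_zero split: list.split)
  have "(\<lambda>w v. case v of [a, b] \<Rightarrow> (case w of [x, y] \<Rightarrow> f a b x y | _ \<Rightarrow> 0) | _ \<Rightarrow> 0)
      = (\<lambda>w v. case w of [x, y] \<Rightarrow> (case v of [a, b] \<Rightarrow> f a b x y | _ \<Rightarrow> 0) | _ \<Rightarrow> 0)"
    by (auto simp: fun_eq_iff split: list.split)
  then show ?thesis
    unfolding eval2_def pull by (subst tensor_eval_swap) (simp add: fun_eq_iff)
qed

lemmas eval2_mult_swap = eval2_mult[THEN trans[OF _ eval2_swap]]

lemma eval3_mult:
  assumes "trilinear f"
  shows "eval3 f (s \<odot> t) = eval3 (\<lambda>a b c. eval3 (\<lambda>x y z. f (a * x) (b * y) (c * z)) t) s"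
proof -
  have "(\<lambda>w. if length v = length w then case map2 (*) v w of [x, y, z] \<Rightarrow> f x y z | _ \<Rightarrow> 0 else 0)
      = (case v of [a, b, c] \<Rightarrow> (\<lambda>w. case w of [x, y, z] \<Rightarrow> f (a * x) (b * y) (c * z) | _ \<Rightarrow> 0)
         | _ \<Rightarrow> (\<lambda>w. 0))" for v
    by (auto simp: fun_eq_iff Suc_length_conv length_Suc_conv split: list.split)
  then show ?thesis
    unfolding eval3_def tensor_eval_mult[OF multilinear_form_triple[OF assms]]
    by (auto simp: tensor_eval_const_zero intro!: arg_cong[where f = "\<lambda>\<phi>. tensor_eval \<phi> s"]
        split: list.split)
qed

lemma eval3_swap:
  "eval3 (\<lambda>a b c. eval3 (\<lambda>x y z. f a b c x y z) t) s = eval3 (\<lambda>x y z. eval3 (\<lambda>a b c. f a b c x y z) s) t"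
proof -
  \<comment> \<open>The case distinction on the outer word moves inside the inner evaluation, so that
    \<open>tensor_eval_swap\<close> applies to plain nested evaluations.\<close>
  have pull: "(case v of [a, b, c] \<Rightarrow> tensor_eval (\<phi> a b c) r | _ \<Rightarrow> 0)
      = tensor_eval (\<lambda>w. case v of [a, b, c] \<Rightarrow> \<phi> a b c w | _ \<Rightarrow> 0) r" for v and \<phi> :: "'a \<Rightarrow> 'a \<Rightarrow> 'a \<Rightarrow> 'a list \<Rightarrow> 'a" and r
    by (auto simp: tensor_eval_const_zero split: list.split)
  have "(\<lambda>w v. case v of [a, b, c] \<Rightarrow> (case w of [x, y, z] \<Rightarrow> f a b c x y z | _ \<Rightarrow> 0) | _ \<Rightarrow> 0)
      = (\<lambda>w v. case w of [x, y, z] \<Rightarrow> (case v of [a, b, c] \<Rightarrow> f a b c x y z | _ \<Rightarrow> 0) | _ \<Rightarrow> 0)"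
    by (auto simp: fun_eq_iff split: list.split)
  then show ?thesis
    unfolding eval3_def pull by (subst tensor_eval_swap) (simp add: fun_eq_iff)
qed

text \<open>
  In a product it is convenient to let the known factor vary in the inner sum, whichever side it is on:
  \<open>eval3_mult\<close> does so for the right factor and \<open>eval3_mult_swap\<close> for the left one.
\<close>

lemmas eval3_mult_swap = eval3_mult[THEN trans[OF _ eval3_swap]]

lemma eval3_cat_one:
  assumes "trilinear f" shows "eval3 f (s \<otimes> \<iota> 1) = eval2 (\<lambda>x y. f x y 1) s"
  unfolding eval3_def eval2_def tensor_eval_cat[OF multilinear_form_triple[OF assms]] inj1_def
    tensor_eval_pure[OF multilinear_form_append_left[OF multilinear_form_triple[OF assms]]]
  by (auto intro!: arg_cong[where f = "\<lambda>\<phi>. tensor_eval \<phi> s"] split: list.split)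

lemma eval3_one_cat:
  assumes "trilinear f" shows "eval3 f (\<iota> 1 \<otimes> s) = eval2 (\<lambda>y z. f 1 y z) s"
  unfolding eval3_def eval2_def tensor_eval_cat[OF multilinear_form_triple[OF assms]] inj1_def
    tensor_eval_swap[of _ s]
    tensor_eval_pure[OF multilinear_form_append_right[OF multilinear_form_triple[OF assms]]]
  by (auto intro!: arg_cong[where f = "\<lambda>\<phi>. tensor_eval \<phi> s"] split: list.split)

text \<open>
  The trailing empty word in the definition of \<open>tensor_map\<close> is a unit for concatenation and disappears.
  Leaving the degrees of \<open>g\<close> and \<open>h\<close> open makes the rule serve both for \<open>\<Delta>\<close>, of degree \<open>2\<close>, and for
  the counit, of degree \<open>0\<close>.
\<close>

lemma tensor_eval_map_pair:
  assumes \<phi>: "multilinear_form \<phi>"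
  shows "tensor_eval \<phi> (tensor_map [g, h] t)
    = eval2 (\<lambda>x y. tensor_eval (\<lambda>v. tensor_eval (\<lambda>w. \<phi> (v @ w)) (h y)) (g x)) t"
proof -
  have "tensor_eval (\<lambda>u. \<phi> (v @ w @ u)) (pure []) = \<phi> (v @ w)" for v w
    using tensor_eval_pure[OF multilinear_form_append_left[OF \<phi>], of "v @ w" "[]"] by simp
  then have "tensor_eval \<phi> (g x \<otimes> h y \<otimes> pure []) = tensor_eval (\<lambda>v. tensor_eval (\<lambda>w. \<phi> (v @ w)) (h y)) (g x)" for x y
    by (simp add: tensor_eval_cat[OF \<phi>] tensor_eval_cat[OF multilinear_form_append_left[OF \<phi>]])
  then show ?thesis
    unfolding tensor_map_def tensor_eval_lift[OF \<phi>] eval2_def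
    by (auto simp: tensor_eval_zero[OF \<phi>] intro!: arg_cong[where f = "\<lambda>\<phi>. tensor_eval \<phi> t"]
        split: list.split)
qed

lemma eval3_map_left:
  assumes "trilinear f"
  shows "eval3 f (tensor_map [g, \<iota>] s) = eval2 (\<lambda>x z. eval2 (\<lambda>p q. f p q z) (g x)) s"
  unfolding eval3_def tensor_eval_map_pair[OF multilinear_form_triple[OF assms]] inj1_def
    tensor_eval_pure[OF multilinear_form_append_left[OF multilinear_form_triple[OF assms]]]
  by (auto simp: eval2_def fun_eq_iff intro!: arg_cong[where f = "\<lambda>f. eval2 f s"] arg_cong[where f = "\<lambda>\<phi>. tensor_eval \<phi> _"] split: list.split)

lemma eval3_map_right:
  assumes "trilinear f"
  shows "eval3 f (tensor_map [\<iota>, g] s) = eval2 (\<lambda>x y. eval2 (\<lambda>p q. f x p q) (g y)) s"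
  unfolding eval3_def tensor_eval_map_pair[OF multilinear_form_triple[OF assms]] inj1_def
    tensor_eval_swap[of _ "g _"]
    tensor_eval_pure[OF multilinear_form_append_right[OF multilinear_form_triple[OF assms]]]
  by (auto simp: eval2_def fun_eq_iff intro!: arg_cong[where f = "\<lambda>f. eval2 f s"] arg_cong[where f = "\<lambda>\<phi>. tensor_eval \<phi> _"] split: list.split)

lemma tensor_eval_singleton_inj1: "tensor_eval (\<lambda>w. case w of [x] \<Rightarrow> x | _ \<Rightarrow> 0) (\<iota> a) = a"
  by (simp add: inj1_def tensor_eval_pure[OF multilinear_form_singleton])

end


section \<open>The counit on a twist and its inverse\<close>

context quasi_bialgebra
begin

text \<open>
  The equation \<open>(\<epsilon> \<otimes> 1) F = 1\<close> of degree-one tensors, read in \<open>H\<close> by evaluating the identity form.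
\<close>

lemma eval2_counit_left:
  assumes "is_twist \<epsilon> F"
  shows "eval2 (\<lambda>x y. scale (\<epsilon> x) y) F = 1"
proof -
  let ?\<phi> = "\<lambda>w. case w of [x] \<Rightarrow> x | _ \<Rightarrow> (0 :: 'a)"
  have *: "tensor_eval (\<lambda>v. ?\<phi> (v @ [y])) (scalar c) = scale c y" for c y
    by (subst tensor_eval_scalar[OF multilinear_form_append_right[OF multilinear_form_singleton]]) simp
  have "tensor_eval ?\<phi> (tensor_map [scalar \<circ> \<epsilon>, \<iota>] F) = eval2 (\<lambda>x y. scale (\<epsilon> x) y) F"
    unfolding tensor_eval_map_pair[OF multilinear_form_singleton] inj1_def comp_def
      tensor_eval_pure[OF multilinear_form_append_left[OF multilinear_form_singleton]] * ..
  with assms show ?thesis by (simp add: is_twist_def tensor_eval_singleton_inj1)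
qed

lemma eval2_counit_right:
  assumes "is_twist \<epsilon> F"
  shows "eval2 (\<lambda>x y. scale (\<epsilon> y) x) F = 1"
proof -
  let ?\<phi> = "\<lambda>w. case w of [x] \<Rightarrow> x | _ \<Rightarrow> (0 :: 'a)"
  have *: "tensor_eval (\<lambda>w. ?\<phi> ([x] @ w)) (scalar c) = scale c x" for c x
    by (subst tensor_eval_scalar[OF multilinear_form_append_left[OF multilinear_form_singleton]]) simp
  have "tensor_eval ?\<phi> (tensor_map [\<iota>, scalar \<circ> \<epsilon>] F) = eval2 (\<lambda>x y. scale (\<epsilon> y) x) F"
    unfolding tensor_eval_map_pair[OF multilinear_form_singleton] inj1_def comp_def
      tensor_eval_swap[of _ "scalar _"]
      tensor_eval_pure[OF multilinear_form_append_right[OF multilinear_form_singleton]] * ..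
  with assms show ?thesis by (simp add: is_twist_def tensor_eval_singleton_inj1)
qed

lemma twist_mult_inv:
  assumes "is_twist \<epsilon> F"
  shows "F \<odot> tensor_inv 2 F = tensor_one 2" "tensor_inv 2 F \<odot> F = tensor_one 2"
  using assms by (simp_all add: is_twist_def tensor_inv_mult)

text \<open>
  The map \<open>1 \<otimes> \<epsilon>\<close> is multiplicative because \<open>\<epsilon>\<close> is, so its value at \<open>F\<^sup>-\<^sup>1\<close> is inverse to its value \<open>1\<close>
  at \<open>F\<close>.
\<close>

lemma eval2_counit_right_inv:
  assumes "is_twist \<epsilon> F"
  shows "eval2 (\<lambda>x y. scale (\<epsilon> y) x) (tensor_inv 2 F) = 1"
proof -
  let ?h = "\<lambda>x y. scale (\<epsilon> y) x"
  have h: "bilinear ?h"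
    by (simp add: bilinear_def counit_add counit_scale algebra_simps)
  have "1 = eval2 ?h (F \<odot> tensor_inv 2 F)"
    by (simp add: twist_mult_inv[OF assms] eval2_one[OF h] counit_one)
  also have "\<dots> = eval2 (\<lambda>a b. eval2 (\<lambda>x y. ?h a b * ?h x y * 1) (tensor_inv 2 F)) F"
    by (simp add: eval2_mult[OF h] counit_mult scale_mult_left scale_mult_right mult.commute)
  also have "\<dots> = eval2 ?h F * eval2 ?h (tensor_inv 2 F)"
    unfolding eval2_times using eval2_times[of 1 ?h "eval2 ?h (tensor_inv 2 F)" F] by simp
  finally show ?thesis by (simp add: eval2_counit_right[OF assms])
qed

end


section \<open>Undoing the twist of the canonical elements\<close>

context quasi_antipode
begin

text \<open>
  The element \<open>\<alpha>\<^sub>F\<close> is a Sweedler sum over \<open>F\<^sup>-\<^sup>1\<close>.  As \<open>S\<close> reverses products, surrounding it by the legs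
  of \<open>F\<close> gives the sum over \<open>F\<^sup>-\<^sup>1 F = 1\<close>.  Dually, \<open>\<beta>\<^sub>F\<close> is a sum over \<open>F\<close> and is surrounded by the legs of
  \<open>F\<^sup>-\<^sup>1\<close>; the order of the product is again \<open>F\<^sup>-\<^sup>1 F\<close>.
\<close>

lemma twist_alpha_untwist:
  assumes "is_twist \<epsilon> F"
  shows "eval2 (\<lambda>x y. S x * twist_alpha F S \<alpha> * y) F = \<alpha>"
proof -
  have b: "bilinear (\<lambda>x y. S x * \<alpha> * y)"
    by (simp add: bilinear_def antipode_add antipode_scale algebra_simps scale_mult_left scale_mult_right)
  have "eval2 (\<lambda>x y. S x * twist_alpha F S \<alpha> * y) F = eval2 (\<lambda>x y. S x * \<alpha> * y) (tensor_inv 2 F \<odot> F)"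
    unfolding eval2_mult_swap[OF b] twist_alpha_def eval2_times[symmetric]
    by (simp add: antipode_mult mult.assoc)
  then show ?thesis
    by (simp add: twist_mult_inv[OF assms] eval2_one[OF b] antipode_one)
qed

lemma twist_beta_untwist:
  assumes "is_twist \<epsilon> F"
  shows "eval2 (\<lambda>x y. x * twist_beta F S \<beta> * S y) (tensor_inv 2 F) = \<beta>"
proof -
  have b: "bilinear (\<lambda>x y. x * \<beta> * S y)"
    by (simp add: bilinear_def antipode_add antipode_scale algebra_simps scale_mult_left scale_mult_right)
  have "eval2 (\<lambda>x y. x * twist_beta F S \<beta> * S y) (tensor_inv 2 F) = eval2 (\<lambda>x y. x * \<beta> * S y) (tensor_inv 2 F \<odot> F)"
    unfolding eval2_mult[OF b] twist_beta_def eval2_times[symmetric]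
    by (simp add: antipode_mult mult.assoc)
  then show ?thesis
    by (simp add: twist_mult_inv[OF assms] eval2_one[OF b] antipode_one)
qed

end


section \<open>Invariance of the comparison element\<close>

locale two_quasi_antipodes =
  quasi_antipode scale \<Delta> \<epsilon> \<Phi> S \<alpha> \<beta> + second: quasi_antipode scale \<Delta> \<epsilon> \<Phi> S' \<alpha>' \<beta>'
  for scale :: "'k::field \<Rightarrow> 'a::ring_1 \<Rightarrow> 'a" and \<Delta> \<epsilon> \<Phi> S \<alpha> \<beta> S' \<alpha>' \<beta>'
begin

lemma trilinear_comparison: "trilinear (\<lambda>x y z. S' x * u * y * w * S z)"
  by (simp add: trilinear_def bilinear_def antipode_add antipode_scale second.antipode_add
      second.antipode_scale algebra_simps scale_mult_left scale_mult_right)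

text \<open>
  The four absorption lemmas hold for every tensor \<open>t\<close>, and two of them for an arbitrary element \<open>w\<close> in
  place of \<open>\<beta>\<close> and two for an arbitrary \<open>u\<close> in place of \<open>\<alpha>'\<close>.  Hence they can be applied in turn while the
  other canonical element is still twisted.
\<close>

lemma comparison_absorb_twist_left:
  assumes "is_twist \<epsilon> F"
  shows "comparison ((F \<otimes> \<iota> 1) \<odot> t) S w S' (twist_alpha F S' \<alpha>') = comparison t S w S' \<alpha>'"
proof -
  let ?u = "twist_alpha F S' \<alpha>'"
  have "eval2 (\<lambda>a b. S' (a * x) * ?u * (b * y) * w * S (1 * z)) F = S' x * \<alpha>' * y * w * S z" for x y z
  proof -
    have "eval2 (\<lambda>a b. S' (a * x) * ?u * (b * y) * w * S (1 * z)) F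
        = eval2 (\<lambda>a b. S' x * (S' a * ?u * b) * (y * w * S z)) F"
      by (simp add: second.antipode_mult mult.assoc)
    then show ?thesis
      by (simp only: eval2_times second.twist_alpha_untwist[OF assms]) (simp add: mult.assoc)
  qed
  then show ?thesis
    unfolding comparison_def eval3_mult_swap[OF trilinear_comparison]
      eval3_cat_one[OF trilinear_shift_left[OF trilinear_comparison]] by simp
qed

lemma comparison_absorb_twist_right:
  assumes "is_twist \<epsilon> F"
  shows "comparison (t \<odot> (\<iota> 1 \<otimes> tensor_inv 2 F)) S (twist_beta F S \<beta>) S' u = comparison t S \<beta> S' u"
proof -
  let ?w = "twist_beta F S \<beta>"
  have "eval2 (\<lambda>b c. S' (x * 1) * u * (y * b) * ?w * S (z * c)) (tensor_inv 2 F) = S' x * u * y * \<beta> * S z" for x y z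
  proof -
    have "eval2 (\<lambda>b c. S' (x * 1) * u * (y * b) * ?w * S (z * c)) (tensor_inv 2 F)
        = eval2 (\<lambda>b c. (S' x * u * y) * (b * ?w * S c) * S z) (tensor_inv 2 F)"
      by (simp add: antipode_mult mult.assoc)
    then show ?thesis
      by (simp only: eval2_times twist_beta_untwist[OF assms])
  qed
  then show ?thesis
    unfolding comparison_def eval3_mult[OF trilinear_comparison]
      eval3_one_cat[OF trilinear_shift_right[OF trilinear_comparison]] by simp
qed

text \<open>
  The legs \<open>p\<close>, \<open>q\<close> of \<open>\<Delta> d\<close> enclose \<open>\<alpha>'\<close> and contract to \<open>\<epsilon> d\<close>.  This scalar moves through the form to the
  second leg \<open>c\<close> of \<open>F\<close>, where \<open>S\<close> can be applied to the whole sum \<open>\<Sum> \<epsilon> d * c = 1\<close>.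
\<close>

lemma comparison_absorb_coprod_left:
  assumes "is_twist \<epsilon> F"
  shows "comparison (tensor_map [\<Delta>, \<iota>] F \<odot> t) S w S' \<alpha>' = comparison t S w S' \<alpha>'"
proof -
  have "eval2 (\<lambda>d c. eval2 (\<lambda>p q. S' (p * x) * \<alpha>' * (q * y) * w * S (c * z)) (\<Delta> d)) F
      = S' x * \<alpha>' * y * w * S z" for x y z
  proof -
    have "eval2 (\<lambda>p q. S' (p * x) * \<alpha>' * (q * y) * w * S (c * z)) (\<Delta> d)
        = S' x * \<alpha>' * y * w * S z * S (scale (\<epsilon> d) c)" for c d
    proof -
      have "eval2 (\<lambda>p q. S' (p * x) * \<alpha>' * (q * y) * w * S (c * z)) (\<Delta> d)
          = eval2 (\<lambda>p q. S' x * (S' p * \<alpha>' * q) * (y * w * S z * S c)) (\<Delta> d)"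
        by (simp add: second.antipode_mult antipode_mult mult.assoc)
      also have "\<dots> = S' x * scale (\<epsilon> d) \<alpha>' * (y * w * S z * S c)"
        by (simp only: eval2_times second.antipode_left)
      finally show ?thesis
        by (simp add: antipode_scale scale_mult_left scale_mult_right mult.assoc)
    qed
    then have "eval2 (\<lambda>d c. eval2 (\<lambda>p q. S' (p * x) * \<alpha>' * (q * y) * w * S (c * z)) (\<Delta> d)) F
        = eval2 (\<lambda>d c. S' x * \<alpha>' * y * w * S z * S (scale (\<epsilon> d) c) * 1) F"
      by simp
    also have "\<dots> = S' x * \<alpha>' * y * w * S z * S (eval2 (\<lambda>d c. scale (\<epsilon> d) c) F)"
      by (simp only: eval2_times eval2_linear[of S] antipode_add antipode_scale) simp
    finally show ?thesis
      by (simp add: eval2_counit_left[OF assms] antipode_one)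
  qed
  then show ?thesis
    unfolding comparison_def eval3_mult_swap[OF trilinear_comparison]
      eval3_map_left[OF trilinear_shift_left[OF trilinear_comparison]] by simp
qed

text \<open>
  The mirror image of the preceding argument: now \<open>\<beta>\<close> contracts the second leg of \<open>F\<^sup>-\<^sup>1\<close>, and the first
  leg is collected under \<open>S'\<close>.
\<close>

lemma comparison_absorb_coprod_right:
  assumes "is_twist \<epsilon> F"
  shows "comparison (t \<odot> tensor_map [\<iota>, \<Delta>] (tensor_inv 2 F)) S \<beta> S' u = comparison t S \<beta> S' u"
proof -
  let ?G = "tensor_inv 2 F"
  have "eval2 (\<lambda>a d. eval2 (\<lambda>p q. S' (x * a) * u * (y * p) * \<beta> * S (z * q)) (\<Delta> d)) ?G
      = S' x * u * y * \<beta> * S z" for x y z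
  proof -
    have "eval2 (\<lambda>p q. S' (x * a) * u * (y * p) * \<beta> * S (z * q)) (\<Delta> d)
        = S' (scale (\<epsilon> d) a) * (S' x * u * y * \<beta> * S z)" for a d
    proof -
      have "eval2 (\<lambda>p q. S' (x * a) * u * (y * p) * \<beta> * S (z * q)) (\<Delta> d)
          = eval2 (\<lambda>p q. (S' a * S' x * u * y) * (p * \<beta> * S q) * S z) (\<Delta> d)"
        by (simp add: second.antipode_mult antipode_mult mult.assoc)
      also have "\<dots> = (S' a * S' x * u * y) * scale (\<epsilon> d) \<beta> * S z"
        by (simp only: eval2_times antipode_right)
      finally show ?thesis
        by (simp add: second.antipode_scale scale_mult_left scale_mult_right mult.assoc)
    qed
    then have "eval2 (\<lambda>a d. eval2 (\<lambda>p q. S' (x * a) * u * (y * p) * \<beta> * S (z * q)) (\<Delta> d)) ?G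
        = eval2 (\<lambda>a d. 1 * S' (scale (\<epsilon> d) a) * (S' x * u * y * \<beta> * S z)) ?G"
      by simp
    also have "\<dots> = S' (eval2 (\<lambda>a d. scale (\<epsilon> d) a) ?G) * (S' x * u * y * \<beta> * S z)"
      by (simp only: eval2_times eval2_linear[of S'] second.antipode_add second.antipode_scale) simp
    finally show ?thesis
      by (simp add: eval2_counit_right_inv[OF assms] second.antipode_one)
  qed
  then show ?thesis
    unfolding comparison_def eval3_mult[OF trilinear_comparison]
      eval3_map_right[OF trilinear_shift_right[OF trilinear_comparison]] by simp
qed

lemma comparison_twist:
  assumes "is_twist \<epsilon> F"
  shows "comparison (twist_associator F \<Delta> \<Phi>) S (twist_beta F S \<beta>) S' (twist_alpha F S' \<alpha>')
    = comparison \<Phi> S \<beta> S' \<alpha>'"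
  \<comment> \<open>The products associate to the left, so the right-hand factors come off first; only then is the
    rest regrouped to expose the left-hand factors.\<close>
  unfolding twist_associator_def comparison_absorb_twist_right[OF assms] comparison_absorb_coprod_right[OF assms]
  unfolding tensor_mult_assoc comparison_absorb_twist_left[OF assms] comparison_absorb_coprod_left[OF assms] ..

end

theorem theorem2:
  fixes scale :: "'k::field \<Rightarrow> 'a::ring_1 \<Rightarrow> 'a"
    and \<Delta> :: "'a \<Rightarrow> ('k, 'a) tensor"
    and \<epsilon> :: "'a \<Rightarrow> 'k"
    and \<Phi> F :: "('k, 'a) tensor"
    and S S' :: "'a \<Rightarrow> 'a"
    and \<alpha> \<beta> \<alpha>' \<beta>' :: 'a
  assumes "quasi_bialgebra scale \<Delta> \<epsilon> \<Phi>"
    and "quasi_antipode scale \<Delta> \<epsilon> \<Phi> S \<alpha> \<beta>"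
    and "quasi_antipode scale \<Delta> \<epsilon> \<Phi> S' \<alpha>' \<beta>'"
    and "assoc_algebra.is_twist scale \<epsilon> F"
  shows "assoc_algebra.comparison scale
           (assoc_algebra.twist_associator scale F \<Delta> \<Phi>)
           S (assoc_algebra.twist_beta scale F S \<beta>)
           S' (assoc_algebra.twist_alpha scale F S' \<alpha>')
         = assoc_algebra.comparison scale \<Phi> S \<beta> S' \<alpha>'"
proof -
  interpret two_quasi_antipodes scale \<Delta> \<epsilon> \<Phi> S \<alpha> \<beta> S' \<alpha>' \<beta>'
    using assms(2,3) by (rule two_quasi_antipodes.intro)
  show ?thesis
    using assms(4) by (rule comparison_twist)
qed

end
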